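(* Let $n\ge3$, let $t$ be an indeterminate, let $f(t),w(t),y(t),v(t)\in\mathbb{Z}[t^{\pm1}]$ with $f(t)$ and $v(t)$ invertible in $\mathbb{Z}[t^{\pm1}]$, and let $\eta_2':VST_n\to\mathrm{GL}_n(\mathbb{Z}[t^{\pm1}])$ be a representation of the virtual singular twin group given, for $1\le i\le n-1$, by $$\eta_2'(s_i)=\begin{pmatrix} I_{i-1}&0&0&0\\0&0&f(t)&0\\0&\frac1{f(t)}&0&0\\0&0&0&I_{n-i-1}\end{pmatrix},\qquad \eta_2'(\tau_i)=\begin{pmatrix} I_{i-1}&0&0&0\\0&w(t)&f^2(t)y(t)&0\\0&y(t)&w(t)&0\\0&0&0&I_{n-i-1}\end{pmatrix},$$ $$\eta_2'(\nu_i)=\begin{pmatrix} I_{i-1}&0&0&0\\0&0&v(t)&0\\0&\frac{1}{v(t)}&0&0\\0&0&0&I_{n-i-1}\end{pmatrix}.$$ Then $\eta_2'$ is unfaithful (that is, not injective).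
   Context: The virtual singular twin group $VST_n$ is the group generated by $s_i,\tau_i,\nu_i$ ($1\le i\le n-1$) subject to: $s_i^2=1$, $\nu_i^2=1$ and $\tau_is_i=s_i\tau_i$ for all $i$; $s_is_j\tau_i=\tau_js_is_j$, $\nu_i\nu_j\nu_i=\nu_j\nu_i\nu_j$, $\nu_is_j\nu_i=\nu_js_i\nu_j$, $\nu_i\tau_j\nu_i=\nu_j\tau_i\nu_j$ for $|i-j|=1$; and $g_ih_j=h_jg_i$ for $|i-j|\ge 2$, where $g_i,h_i\in\{s_i,\tau_i,\nu_i\}$. $I_r$ is the $r\times r$ identity matrix. *)

theory Defs
  imports "HOL-Library.Poly_Mapping" "Jordan_Normal_Form.Matrix"
begin

section \<open>Groups given by generators and relations\<close>

text \<open>A letter \<open>(x, True)\<close> stands for the generator \<open>x\<close> and \<open>(x, False)\<close> for its formal inverse.\<close>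

type_synonym 'a word = "('a \<times> bool) list"

definition words :: "'a set \<Rightarrow> 'a word set" where
  "words X = lists (X \<times> UNIV)"

text \<open>A pair \<open>(l, r)\<close> in \<open>R\<close> is the defining relation \<open>l = r\<close>.\<close>

inductive_set pres_rel :: "'a set \<Rightarrow> ('a word \<times> 'a word) set \<Rightarrow> ('a word \<times> 'a word) set"
  for X :: "'a set" and R :: "('a word \<times> 'a word) set"
where
  refl: "u \<in> words X \<Longrightarrow> (u, u) \<in> pres_rel X R"
| sym: "(u, v) \<in> pres_rel X R \<Longrightarrow> (v, u) \<in> pres_rel X R"
| trans: "(u, v) \<in> pres_rel X R \<Longrightarrow> (v, w) \<in> pres_rel X R \<Longrightarrow> (u, w) \<in> pres_rel X R"
| append: "(u, u') \<in> pres_rel X R \<Longrightarrow> (v, v') \<in> pres_rel X R \<Longrightarrow> (u @ v, u' @ v') \<in> pres_rel X R"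
| cancel: "x \<in> X \<Longrightarrow> ([(x, b), (x, \<not> b)], []) \<in> pres_rel X R"
| relation: "(l, r) \<in> R \<Longrightarrow> l \<in> words X \<Longrightarrow> r \<in> words X \<Longrightarrow> (l, r) \<in> pres_rel X R"

definition word_class :: "'a set \<Rightarrow> ('a word \<times> 'a word) set \<Rightarrow> 'a word \<Rightarrow> 'a word set" where
  "word_class X R u = pres_rel X R `` {u}"

definition presented_group :: "'a set \<Rightarrow> ('a word \<times> 'a word) set \<Rightarrow> 'a word set monoid" where
  "presented_group X R =
    \<lparr>carrier = words X // pres_rel X R,
     monoid.mult = (\<lambda>A B. \<Union>a\<in>A. \<Union>b\<in>B. word_class X R (a @ b)),
     one = word_class X R []\<rparr>"

definition gen_class :: "'a set \<Rightarrow> ('a word \<times> 'a word) set \<Rightarrow> 'a \<Rightarrow> 'a word set" where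
  "gen_class X R x = word_class X R [(x, True)]"

lemma words_simps [simp]:
  "[] \<in> words X"
  "p # u \<in> words X \<longleftrightarrow> fst p \<in> X \<and> u \<in> words X"
  "u @ v \<in> words X \<longleftrightarrow> u \<in> words X \<and> v \<in> words X"
  by (simp_all add: words_def mem_Times_iff)

lemma pres_rel_words: "(u, v) \<in> pres_rel X R \<Longrightarrow> u \<in> words X \<and> v \<in> words X"
  by (induction rule: pres_rel.induct) auto

lemma equiv_pres_rel: "equiv (words X) (pres_rel X R)"
proof (rule equivI)
  show "pres_rel X R \<subseteq> words X \<times> words X"
    by (auto dest: pres_rel_words)
  show "refl_on (words X) (pres_rel X R)"
    by (rule refl_onI) (rule pres_rel.refl)
  show "sym (pres_rel X R)"
    by (rule symI) (rule pres_rel.sym)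
  show "trans (pres_rel X R)"
    by (rule transI) (rule pres_rel.trans)
qed

lemma word_class_eq_iff:
  "u \<in> words X \<Longrightarrow> v \<in> words X \<Longrightarrow>
    word_class X R u = word_class X R v \<longleftrightarrow> (u, v) \<in> pres_rel X R"
  unfolding word_class_def by (rule eq_equiv_class_iff[OF equiv_pres_rel])

lemma carrier_presented_group:
  "carrier (presented_group X R) = word_class X R ` words X"
  by (auto simp: presented_group_def word_class_def quotient_def)

lemma one_presented_group: "\<one>\<^bsub>presented_group X R\<^esub> = word_class X R []"
  by (simp add: presented_group_def)

lemma mult_presented_group:
  assumes "u \<in> words X" "v \<in> words X"
  shows "word_class X R u \<otimes>\<^bsub>presented_group X R\<^esub> word_class X R v = word_class X R (u @ v)"
proof -
  have eq: "word_class X R (a @ b) = word_class X R (u @ v)"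
    if "a \<in> word_class X R u" "b \<in> word_class X R v" for a b
  proof -
    have "(u @ v, a @ b) \<in> pres_rel X R"
      using that by (auto simp: word_class_def intro!: pres_rel.append)
    then show ?thesis
      unfolding word_class_def by (rule equiv_class_eq[OF equiv_pres_rel, symmetric])
  qed
  have "u \<in> word_class X R u" "v \<in> word_class X R v"
    using assms by (simp_all add: word_class_def pres_rel.refl)
  then have "(\<Union>a\<in>word_class X R u. \<Union>b\<in>word_class X R v. word_class X R (u @ v))
      = word_class X R (u @ v)"
    by blast
  moreover have "(\<Union>a\<in>word_class X R u. \<Union>b\<in>word_class X R v. word_class X R (a @ b))
      = (\<Union>a\<in>word_class X R u. \<Union>b\<in>word_class X R v. word_class X R (u @ v))"
    by (intro SUP_cong HOL.refl) (rule eq)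
  ultimately show ?thesis
    by (simp only: presented_group_def monoid.simps)
qed

definition word_inv :: "'a word \<Rightarrow> 'a word" where
  "word_inv u = rev (map (\<lambda>(x, b). (x, \<not> b)) u)"

lemma word_inv_words: "u \<in> words X \<Longrightarrow> word_inv u \<in> words X"
  by (induction u) (auto simp: word_inv_def split: prod.splits)

lemma word_inv_left: "u \<in> words X \<Longrightarrow> (word_inv u @ u, []) \<in> pres_rel X R"
proof (induction u)
  case Nil
  then show ?case by (simp add: word_inv_def pres_rel.refl)
next
  case (Cons p u)
  obtain x b where p: "p = (x, b)" by (cases p)
  have x: "x \<in> X" and u: "u \<in> words X" using Cons.prems p by auto
  have "([(x, \<not> b), (x, b)], []) \<in> pres_rel X R"
    using pres_rel.cancel[OF x, of "\<not> b"] by simp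
  then have "([(x, \<not> b), (x, b)] @ u, [] @ u) \<in> pres_rel X R"
    by (rule pres_rel.append) (rule pres_rel.refl[OF u])
  then have "(word_inv u @ ([(x, \<not> b), (x, b)] @ u), word_inv u @ ([] @ u)) \<in> pres_rel X R"
    by (rule pres_rel.append[OF pres_rel.refl[OF word_inv_words[OF u]]])
  then have "(word_inv (p # u) @ p # u, word_inv u @ u) \<in> pres_rel X R"
    by (simp add: word_inv_def p)
  then show ?case using Cons.IH[OF u] by (rule pres_rel.trans)
qed

lemma group_presented_group: "group (presented_group X R)" (is "group ?G")
proof (rule groupI)
  have repr: "\<exists>u\<in>words X. A = word_class X R u" if "A \<in> carrier ?G" for A
    using that unfolding carrier_presented_group by blast
  have word_class_closed: "word_class X R u \<in> carrier ?G" if "u \<in> words X" for u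
    using that unfolding carrier_presented_group by blast
  show "\<one>\<^bsub>?G\<^esub> \<in> carrier ?G"
    by (simp add: one_presented_group word_class_closed)
  show "A \<otimes>\<^bsub>?G\<^esub> B \<in> carrier ?G" if A: "A \<in> carrier ?G" and B: "B \<in> carrier ?G" for A B
    using repr[OF A] repr[OF B] by (elim bexE) (simp add: mult_presented_group word_class_closed)
  show "A \<otimes>\<^bsub>?G\<^esub> B \<otimes>\<^bsub>?G\<^esub> C = A \<otimes>\<^bsub>?G\<^esub> (B \<otimes>\<^bsub>?G\<^esub> C)"
    if A: "A \<in> carrier ?G" and B: "B \<in> carrier ?G" and C: "C \<in> carrier ?G" for A B C
    using repr[OF A] repr[OF B] repr[OF C] by (elim bexE) (simp add: mult_presented_group)
  show "\<one>\<^bsub>?G\<^esub> \<otimes>\<^bsub>?G\<^esub> A = A" if A: "A \<in> carrier ?G" for A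
    using repr[OF A] by (elim bexE) (simp add: one_presented_group mult_presented_group)
  show "\<exists>B\<in>carrier ?G. B \<otimes>\<^bsub>?G\<^esub> A = \<one>\<^bsub>?G\<^esub>" if A: "A \<in> carrier ?G" for A
  proof -
    obtain u where u: "u \<in> words X" and A_eq: "A = word_class X R u"
      using repr[OF A] by blast
    have "word_class X R (word_inv u) \<otimes>\<^bsub>?G\<^esub> A = \<one>\<^bsub>?G\<^esub>"
      using u word_inv_left[OF u]
      by (simp add: A_eq mult_presented_group word_inv_words one_presented_group word_class_eq_iff)
    then show ?thesis
      using word_class_closed[OF word_inv_words[OF u]] by (rule bexI)
  qed
qed


section \<open>The virtual singular twin group\<close>

datatype vst_gen = S nat | Tau nat | Nu nat

definition vst_gens :: "nat \<Rightarrow> vst_gen set" where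
  "vst_gens n = (\<Union>i\<in>{1..n-1}. {S i, Tau i, Nu i})"

definition pos :: "'a list \<Rightarrow> 'a word" where
  "pos xs = map (\<lambda>x. (x, True)) xs"

definition vst_rels :: "nat \<Rightarrow> (vst_gen word \<times> vst_gen word) set" where
  "vst_rels n =
    (\<Union>i\<in>{1..n-1}.
      {(pos [S i, S i], []),
       (pos [Nu i, Nu i], []),
       (pos [Tau i, S i], pos [S i, Tau i])}) \<union>
    (\<Union>i\<in>{1..n-1}. \<Union>j\<in>{j\<in>{1..n-1}. \<bar>int i - int j\<bar> = 1}.
      {(pos [S i, S j, Tau i], pos [Tau j, S i, S j]),
       (pos [Nu i, Nu j, Nu i], pos [Nu j, Nu i, Nu j]),
       (pos [Nu i, S j, Nu i], pos [Nu j, S i, Nu j]),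
       (pos [Nu i, Tau j, Nu i], pos [Nu j, Tau i, Nu j])}) \<union>
    (\<Union>i\<in>{1..n-1}. \<Union>j\<in>{j\<in>{1..n-1}. \<bar>int i - int j\<bar> \<ge> 2}.
      \<Union>g\<in>{S, Tau, Nu}. \<Union>h\<in>{S, Tau, Nu}.
      {(pos [g i, h j], pos [h j, g i])})"

definition VST :: "nat \<Rightarrow> vst_gen word set monoid" where
  "VST n = presented_group (vst_gens n) (vst_rels n)"

definition vst_class :: "nat \<Rightarrow> vst_gen \<Rightarrow> vst_gen word set" where
  "vst_class n = gen_class (vst_gens n) (vst_rels n)"


section \<open>Matrices over the integral Laurent polynomials\<close>

text \<open>
  Finitely supported functions from exponents in \<open>int\<close> to coefficients in \<open>int\<close>, with convolution
  as product, are the integral Laurent polynomials in one indeterminate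
  \<open>t = Poly_Mapping.single 1 1\<close>.
\<close>

type_synonym laurent = "int \<Rightarrow>\<^sub>0 int"

text \<open>The reciprocal of a unit; unspecified when \<open>a\<close> is not a unit.\<close>

definition unit_inv :: "'a::comm_ring_1 \<Rightarrow> 'a" where
  "unit_inv a = (THE b. a * b = 1)"

lemma unit_inv:
  assumes "a dvd 1"
  shows "a * unit_inv a = 1"
proof -
  obtain b where "1 = a * b"
    using assms by (rule dvdE)
  then have b: "a * b = 1" by (rule HOL.sym)
  have "c = b" if "a * c = 1" for c
  proof -
    have "c = c * (a * b)" by (simp only: b mult_1_right)
    also have "\<dots> = (a * c) * b" by (simp only: ac_simps)
    finally show ?thesis by (simp only: that mult_1_left)
  qed
  with b show ?thesis
    unfolding unit_inv_def by (rule theI)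
qed

definition GL :: "nat \<Rightarrow> 'a::comm_ring_1 mat monoid" where
  "GL n = units_of (ring_mat TYPE('a) n ())"

definition local_mat :: "nat \<Rightarrow> nat \<Rightarrow> 'a::comm_ring_1 \<Rightarrow> 'a \<Rightarrow> 'a \<Rightarrow> 'a \<Rightarrow> 'a mat" where
  "local_mat n i a b c d =
    diag_block_mat [1\<^sub>m (i - 1), mat_of_rows_list 2 [[a, b], [c, d]], 1\<^sub>m (n - i - 1)]"

end

theory Submission
  imports Defs
begin

text \<open>
  Put \<open>\<lambda> = s\<^sub>1\<nu>\<^sub>1\<close>. Its image is the diagonal matrix with entries \<open>f/v, v/f, 1, \<dots>, 1\<close>, and the images
  of \<open>s\<^sub>2\<nu>\<^sub>2\<close> and \<open>\<nu>\<^sub>2\<lambda>\<nu>\<^sub>2\<close> are the diagonal matrices with entries \<open>1, f/v, v/f, 1, \<dots>\<close> and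
  \<open>f/v, 1, v/f, 1, \<dots>\<close>. Diagonal matrices multiply entrywise, so \<open>\<lambda> \<cdot> s\<^sub>2\<nu>\<^sub>2\<close> and \<open>\<nu>\<^sub>2\<lambda>\<nu>\<^sub>2\<close> have the same
  image; after cancelling the last \<open>\<nu>\<^sub>2\<close> this says that \<open>s\<^sub>1\<nu>\<^sub>1s\<^sub>2\<close> and \<open>\<nu>\<^sub>2s\<^sub>1\<nu>\<^sub>1\<close> have the same image
  (lemma \<open>monomial_coincidence\<close>).

  These two elements differ in the group: every defining relation has the same number of letters \<open>s\<^sub>i\<close>
  modulo 2 on both sides, so the parity of that number is a character of the group
  (lemma \<open>pres_rel_s_count_parity\<close>). It is even on \<open>s\<^sub>1\<nu>\<^sub>1s\<^sub>2\<close> and odd on \<open>\<nu>\<^sub>2s\<^sub>1\<nu>\<^sub>1\<close>.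
\<close>

definition s_count :: "vst_gen word \<Rightarrow> nat" where
  "s_count u = length (filter (\<lambda>p. \<exists>i. fst p = S i) u)"

lemma s_count_simps [simp]:
  "s_count [] = 0"
  "s_count ((S i, b) # u) = Suc (s_count u)"
  "s_count ((Tau i, b) # u) = s_count u"
  "s_count ((Nu i, b) # u) = s_count u"
  "s_count (u @ u') = s_count u + s_count u'"
  by (simp_all add: s_count_def)

text \<open>
  The relations \<open>s\<^sub>i\<^sup>2 = 1\<close> change the number of letters \<open>s\<^sub>i\<close> by 2, as may a cancellation; all other
  relations preserve it.
\<close>

lemma pres_rel_s_count_parity:
  "(u, u') \<in> pres_rel (vst_gens n) (vst_rels n) \<Longrightarrow> even (s_count u) = even (s_count u')"
proof (induction rule: pres_rel.induct)
  case (cancel x b)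
  then show ?case by (cases x) simp_all
next
  case (relation l r)
  then show ?case by (auto simp: vst_rels_def pos_def)
qed simp_all

lemma local_mat_carrier: "1 \<le> i \<Longrightarrow> i < n \<Longrightarrow> local_mat n i a b c d \<in> carrier_mat n n"
  by (rule carrier_matI) (simp_all add: local_mat_def Let_def mat_of_rows_list_def)

lemma local_mat_index:
  assumes "1 \<le> i" "i < n" "r < n" "k < n"
  shows "local_mat n i a b c d $$ (r, k) =
    (if r = i - 1 then if k = i - 1 then a else if k = i then b else 0
     else if r = i then if k = i - 1 then c else if k = i then d else 0
     else if r = k then 1 else 0)"
proof -
  obtain p where i: "i = Suc p"
    using assms(1) by (cases i) auto
  obtain q where n: "n = Suc (Suc (p + q))"
    using assms(2) i less_imp_Suc_add[of i n] by auto
  show ?thesis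
    using assms(3,4) unfolding i n
    by (auto simp: local_mat_def Let_def mat_of_rows_list_def nth_Cons' not_less)
qed

text \<open>
  Stated as a row operation, so that products of several monomial matrices can be computed one
  factor at a time.
\<close>

lemma monomial_local_mat_mult:
  assumes i: "1 \<le> i" "i < n" and A: "A \<in> carrier_mat n n"
  shows "local_mat n i 0 b c 0 * A = mat n n (\<lambda>(r, k).
    if r = i - 1 then b * A $$ (i, k) else if r = i then c * A $$ (i - 1, k) else A $$ (r, k))"
    (is "?L * A = ?B")
proof (rule eq_matI)
  fix r k assume "r < dim_row ?B" "k < dim_col ?B"
  then have rk: "r < n" "k < n" by simp_all
  \<comment> \<open>Row \<open>r\<close> of the left factor is \<open>x\<close> times the unit row vector with index \<open>q\<close>.\<close>
  define x where "x = (if r = i - 1 then b else if r = i then c else 1)"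
  define q where "q = (if r = i - 1 then i else if r = i then i - 1 else r)"
  have q: "q < n" using i rk by (auto simp: q_def)
  have entry: "?L $$ (r, m) = (if m = q then x else 0)" if "m < n" for m
    using i rk that by (auto simp: local_mat_index x_def q_def)
  have "(?L * A) $$ (r, k) = (\<Sum>m = 0..<n. ?L $$ (r, m) * A $$ (m, k))"
    using rk A local_mat_carrier[OF i, of 0 b c 0] by (auto simp: scalar_prod_def)
  also have "\<dots> = (\<Sum>m = 0..<n. if m = q then x * A $$ (m, k) else 0)"
    by (rule sum.cong) (simp_all add: entry)
  also have "\<dots> = x * A $$ (q, k)"
    using q by simp
  finally show "(?L * A) $$ (r, k) = ?B $$ (r, k)"
    using i rk by (auto simp: x_def q_def)
qed (use A local_mat_carrier[OF i, of 0 b c 0] in auto)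

text \<open>
  Both sides have the entry \<open>f v'\<close> at \<open>(1, 1)\<close>, \<open>v\<close> at \<open>(2, 3)\<close>, \<open>f'\<close> at \<open>(3, 2)\<close> and agree with the
  identity from the fourth row on. The entry \<open>v\<close> arises on the left as \<open>f' v f\<close>, and \<open>f'\<close> arises on
  the right as \<open>v' f' v\<close>.
\<close>

lemma monomial_coincidence:
  fixes f f' v v' :: "'a :: comm_ring_1"
  assumes n: "n \<ge> 3" and ff: "f * f' = 1" and vv: "v * v' = 1"
  shows "local_mat n 1 0 f f' 0 * (local_mat n 1 0 v v' 0 * local_mat n 2 0 f f' 0) =
    local_mat n 2 0 v v' 0 * (local_mat n 1 0 f f' 0 * local_mat n 1 0 v v' 0)"
proof -
  have c: "1 \<le> (1::nat)" "1 < n" "1 \<le> (2::nat)" "2 < n" using n by simp_all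
  note C = local_mat_carrier[OF c(1,2)] local_mat_carrier[OF c(3,4)]
  have canc: "f' * (v * f) = v" "v' * (f' * v) = f'"
  proof -
    have "f' * (v * f) = v * (f * f')" "v' * (f' * v) = f' * (v * v')"
      by (simp_all only: ac_simps)
    then show "f' * (v * f) = v" "v' * (f' * v) = f'"
      by (simp_all add: ff vv)
  qed
  note row_ops = monomial_local_mat_mult[OF c(1,2)] monomial_local_mat_mult[OF c(3,4)] C mat_carrier
  show ?thesis (is "?L = ?R")
  proof (rule eq_matI)
    fix r k assume "r < dim_row ?R" "k < dim_col ?R"
    then have "r < n" "k < n"
      using C(1)[of 0 v v' 0] C(2)[of 0 v v' 0] by auto
    then show "?L $$ (r, k) = ?R $$ (r, k)"
      using n by (simp only: row_ops) (auto simp: local_mat_index canc)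
  qed (simp_all only: row_ops dim_row_mat dim_col_mat)
qed

lemma mult_GL: "A \<otimes>\<^bsub>GL n\<^esub> B = A * B"
  by (simp add: GL_def units_of_def ring_mat_def)

lemma hom_GL_three_letters:
  assumes h: "\<eta> \<in> hom (VST n) (GL n)" and g: "{g1, g2, g3} \<subseteq> vst_gens n"
  shows "\<eta> (word_class (vst_gens n) (vst_rels n) (pos [g1, g2, g3])) =
    \<eta> (vst_class n g1) * (\<eta> (vst_class n g2) * \<eta> (vst_class n g3))"
proof -
  let ?c = "word_class (vst_gens n) (vst_rels n)"
  have mult: "\<eta> (?c (u @ u')) = \<eta> (?c u) * \<eta> (?c u')"
    if "u \<in> words (vst_gens n)" "u' \<in> words (vst_gens n)" for u u'
    using hom_mult[OF h, of "?c u" "?c u'"] that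
    by (simp add: VST_def mult_presented_group carrier_presented_group mult_GL)
  show ?thesis
    using g mult[of "[(g1, True)]" "[(g2, True), (g3, True)]"]
      mult[of "[(g2, True)]" "[(g3, True)]"]
    by (simp add: pos_def vst_class_def gen_class_def)
qed

theorem proposition19:
  fixes n :: nat and f w y v :: laurent and \<eta> :: "vst_gen word set \<Rightarrow> laurent mat"
  assumes "n \<ge> 3"
    and "f dvd 1" and "v dvd 1"
    and "\<eta> \<in> hom (VST n) (GL n)"
    and "\<And>i. 1 \<le> i \<Longrightarrow> i \<le> n - 1 \<Longrightarrow>
          \<eta> (vst_class n (S i)) = local_mat n i 0 f (unit_inv f) 0"
    and "\<And>i. 1 \<le> i \<Longrightarrow> i \<le> n - 1 \<Longrightarrow>
          \<eta> (vst_class n (Tau i)) = local_mat n i w (f\<^sup>2 * y) y w"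
    and "\<And>i. 1 \<le> i \<Longrightarrow> i \<le> n - 1 \<Longrightarrow>
          \<eta> (vst_class n (Nu i)) = local_mat n i 0 v (unit_inv v) 0"
  shows "\<not> inj_on \<eta> (carrier (VST n))"
proof
  assume inj: "inj_on \<eta> (carrier (VST n))"
  let ?c = "word_class (vst_gens n) (vst_rels n)"
  let ?u = "pos [S 1, Nu 1, S 2]" and ?u' = "pos [Nu 2, S 1, Nu 1]"
  have gens: "{S 1, S 2, Nu 1, Nu 2} \<subseteq> vst_gens n"
    using assms(1) by (auto simp: vst_gens_def)
  then have words: "?u \<in> words (vst_gens n)" "?u' \<in> words (vst_gens n)"
    by (simp_all add: pos_def)
  have "\<eta> (?c ?u) = \<eta> (?c ?u')"
    using gens assms(1) monomial_coincidence[OF assms(1) unit_inv[OF assms(2)] unit_inv[OF assms(3)]]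
    by (simp add: hom_GL_three_letters[OF assms(4)] assms(5,7))
  then have "?c ?u = ?c ?u'"
    using inj words by (auto simp: VST_def carrier_presented_group dest: inj_onD)
  then have "(?u, ?u') \<in> pres_rel (vst_gens n) (vst_rels n)"
    using words by (simp add: word_class_eq_iff)
  from pres_rel_s_count_parity[OF this] show False
    by (simp add: pos_def)
qed

end
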